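(* Let $n(R)=\lceil 2R^2\rceil$ for $R>0$. Then $$\rho_{\mathbb{C}}=\liminf_{R\to\infty}\inf_{f\in\operatorname{Pol}_{n(R)}(\mathbb{C})}\frac{1}{R^2}\int_{\mathbb{D}(0,R)}\Psi_f(z,R)\,dA(z)$$ and $$\rho_{\mathbb{C}}^*=\liminf_{R\to\infty}\inf_{f\in\operatorname{Pol}_{n(R)}(\mathbb{C})}\frac{1}{R^2}\int_{\mathbb{C}}\Psi_f(z,R)\,dA(z).$$
   Context: Notation: $\mathbb{D}(0,R)=\{z\in\mathbb{C}:|z|<R\}$, $dA(z)=\frac{dx\,dy}{\pi}$ for $z=x+iy$; $\lceil x\rceil$ is the smallest integer $n$ with $n\ge x$. $\operatorname{Pol}(\mathbb{C})$ is the set of all complex polynomials in one variable, and $\operatorname{Pol}_n(\mathbb{C})$ is the set of those of degree at most $n-1$. For $R>0$ and an entire function $f$ put $$\Psi_f(z,R)=\left(|f(z)|e^{-|z|^2}-1_{\mathbb{D}(0,R)}(z)\right)^2,\qquad z\in\mathbb{C},$$ and define $$\rho_{\mathbb{C}}=\liminf_{R\to\infty}\inf_{f\in\operatorname{Pol}(\mathbb{C})}\frac{1}{R^2}\int_{\mathbb{D}(0,R)}\Psi_f(z,R)\,dA(z),\qquad \rho_{\mathbb{C}}^*=\liminf_{R\to\infty}\inf_{f\in\operatorname{Pol}(\mathbb{C})}\frac{1}{R^2}\int_{\mathbb{C}}\Psi_f(z,R)\,dA(z).$$ *)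

theory Defs
  imports "HOL-Analysis.Analysis" "HOL-Computational_Algebra.Polynomial"
begin

definition dA :: "complex measure" where
  "dA = density lborel (\<lambda>_. ennreal (1 / pi))"

definition Pol :: "complex poly set" where
  "Pol = UNIV"

(* Degree at most n - 1; the zero polynomial has "degree 0 = 0" in the library, so it is
   listed separately to belong also to the degenerate space Pol_n 0. *)
definition Pol_n :: "nat \<Rightarrow> complex poly set" where
  "Pol_n n = {p. p = 0 \<or> degree p < n}"

definition Psi :: "(complex \<Rightarrow> complex) \<Rightarrow> complex \<Rightarrow> real \<Rightarrow> real" where
  "Psi f z R = (cmod (f z) * exp (- (cmod z)\<^sup>2) - indicator (ball 0 R) z)\<^sup>2"

(* For polynomial f the integrands below are integrable (polynomial growth against Gaussian
   decay), so the Bochner integral is the usual one. Infima and lower limits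
   are taken in ereal, so that they need no boundedness side conditions. *)
definition disc_mean :: "(complex \<Rightarrow> complex) \<Rightarrow> real \<Rightarrow> real" where
  "disc_mean f R = 1 / R\<^sup>2 * (LINT z:ball 0 R|dA. Psi f z R)"

definition plane_mean :: "(complex \<Rightarrow> complex) \<Rightarrow> real \<Rightarrow> real" where
  "plane_mean f R = 1 / R\<^sup>2 * (LINT z|dA. Psi f z R)"

definition rho :: ereal where
  "rho = Liminf at_top (\<lambda>R. INF p\<in>Pol. ereal (disc_mean (poly p) R))"

definition rho_star :: ereal where
  "rho_star = Liminf at_top (\<lambda>R. INF p\<in>Pol. ereal (plane_mean (poly p) R))"

end

theory Submission
  imports Defs
begin

text \<open>Given a nearly optimal polynomial \<open>p\<close> for the radius \<open>R\<close>, cut \<open>p\<close> off at degree \<open>2 s\<close> for some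
  \<open>s\<close> slightly below \<open>R\<^sup>2\<close>. Monomials are orthogonal for the Gaussian weight on every rotation
  invariant set, and for \<open>k \<ge> 2 s\<close> the weighted mass of \<open>z\<^sup>k\<close> in the disc \<open>|z|\<^sup>2 < s\<close> is at most a
  constant times its mass in the annulus \<open>s \<le> |z|\<^sup>2 < s + R\<close>, because \<open>t\<^sup>k exp (- 2 t)\<close> increases up to
  \<open>t = k / 2\<close> and varies on the scale \<open>R\<close>. So the discarded tail is controlled, in the disc, by the
  mass of \<open>p\<close> in the annulus. Among \<open>N\<close> disjoint annuli just inside the disc of radius \<open>R\<close> one
  carries at most \<open>1/N\<close> of the mass of \<open>p\<close>, which is \<open>O(R\<^sup>2)\<close>. Outside the disc, orthogonality shows
  that the cut-off only decreases the mass. The cut-off polynomial is thus nearly optimal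
  for the radius \<open>\<surd>s\<close>, and the change of radius does not affect the lower limit.\<close>

subsection \<open>Rotations and the area measure\<close>

lemma measurable_Complex [measurable]:
  "(\<lambda>(x, y). Complex x y) \<in> borel_measurable (lborel \<Otimes>\<^sub>M lborel)"
  unfolding lborel_prod measurable_lborel2 case_prod_unfold Complex_eq
  by (intro borel_measurable_continuous_onI continuous_intros)

text \<open>Lebesgue measure is determined by its values on open boxes, and a box in the plane is a
  product of two intervals. This opens the way to Fubini in real coordinates.\<close>

lemma distr_Complex: "distr (lborel \<Otimes>\<^sub>M lborel) borel (\<lambda>(x, y). Complex x y) = lborel"
proof (rule lborel_eqI[symmetric])
  fix l u :: complex
  have eq: "(\<lambda>(x, y). Complex x y) -` box l u = {Re l<..<Re u} \<times> {Im l<..<Im u}"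
    by (auto simp: box_complex_eq)
  assume le: "\<And>b. b \<in> Basis \<Longrightarrow> l \<bullet> b \<le> u \<bullet> b"
  have "Re l \<le> Re u" "Im l \<le> Im u"
    using le[of 1] le[of \<i>] by auto
  then show "emeasure (distr (lborel \<Otimes>\<^sub>M lborel) borel (\<lambda>(x, y). Complex x y)) (box l u) =
      ennreal (\<Prod>b\<in>Basis. (u - l) \<bullet> b)"
    by (simp add: emeasure_distr eq space_pair_measure lborel.emeasure_pair_measure_Times
        Basis_complex_def ennreal_mult)
qed simp

text \<open>Both orders are recorded because each kind of shear needs the inner integral along the
  direction in which it moves points.\<close>

lemma nn_integral_complex:
  assumes [measurable]: "f \<in> borel_measurable borel"
  shows "(\<integral>\<^sup>+z. f z \<partial>lborel) = (\<integral>\<^sup>+x. \<integral>\<^sup>+y. f (Complex x y) \<partial>lborel \<partial>lborel)"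
    and "(\<integral>\<^sup>+z. f z \<partial>lborel) = (\<integral>\<^sup>+y. \<integral>\<^sup>+x. f (Complex x y) \<partial>lborel \<partial>lborel)"
proof -
  have "(\<integral>\<^sup>+z. f z \<partial>lborel) = (\<integral>\<^sup>+p. f (case p of (x, y) \<Rightarrow> Complex x y) \<partial>(lborel \<Otimes>\<^sub>M lborel))"
    by (subst distr_Complex[symmetric], subst nn_integral_distr) auto
  also have "\<dots> = (\<integral>\<^sup>+p. (case p of (x, y) \<Rightarrow> f (Complex x y)) \<partial>(lborel \<Otimes>\<^sub>M lborel))"
    by (simp add: case_prod_unfold)
  finally have *: "(\<integral>\<^sup>+z. f z \<partial>lborel) = \<dots>" .
  have [measurable]: "(\<lambda>(x, y). f (Complex x y)) \<in> borel_measurable (lborel \<Otimes>\<^sub>M lborel)"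
    using measurable_compose[OF measurable_Complex assms] by (simp add: case_prod_unfold)
  show "(\<integral>\<^sup>+z. f z \<partial>lborel) = (\<integral>\<^sup>+x. \<integral>\<^sup>+y. f (Complex x y) \<partial>lborel \<partial>lborel)"
    unfolding * by (subst lborel.nn_integral_fst[symmetric]) auto
  then show "(\<integral>\<^sup>+z. f z \<partial>lborel) = (\<integral>\<^sup>+y. \<integral>\<^sup>+x. f (Complex x y) \<partial>lborel \<partial>lborel)"
    by (subst lborel_pair.Fubini') (auto)
qed

text \<open>A shear translates every horizontal (or every vertical) line by a constant, so
  translation invariance of the inner one-dimensional integral suffices.\<close>

lemma nn_integral_shear:
  fixes t :: real
  assumes [measurable]: "f \<in> borel_measurable borel"
  shows "(\<integral>\<^sup>+z. f (z + of_real (t * Im z)) \<partial>lborel) = (\<integral>\<^sup>+z. f z \<partial>lborel)"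
    and "(\<integral>\<^sup>+z. f (z + \<i> * of_real (t * Re z)) \<partial>lborel) = (\<integral>\<^sup>+z. f z \<partial>lborel)"
proof -
  have [measurable]: "(\<lambda>z. z + of_real (t * Im z)) \<in> borel_measurable borel"
    "(\<lambda>z. z + \<i> * of_real (t * Re z)) \<in> borel_measurable borel"
    by measurable
  have [measurable]: "(\<lambda>x. f (Complex x y)) \<in> borel_measurable borel"
    "(\<lambda>y. f (Complex x y)) \<in> borel_measurable borel" for x y
    by (simp_all add: Complex_eq)
  have "(\<integral>\<^sup>+x. f (Complex (x + t * y) y) \<partial>lborel) = (\<integral>\<^sup>+x. f (Complex x y) \<partial>lborel)" for y
    using nn_integral_real_affine[of "\<lambda>x. f (Complex x y)" 1 "t * y"] by (simp add: add.commute)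
  moreover have "Complex x y + of_real (t * y) = Complex (x + t * y) y" for x y
    by (simp add: complex_eq_iff)
  ultimately show "(\<integral>\<^sup>+z. f (z + of_real (t * Im z)) \<partial>lborel) = (\<integral>\<^sup>+z. f z \<partial>lborel)"
    by (simp add: nn_integral_complex(2) del: of_real_mult)
  have "(\<integral>\<^sup>+y. f (Complex x (y + t * x)) \<partial>lborel) = (\<integral>\<^sup>+y. f (Complex x y) \<partial>lborel)" for x
    using nn_integral_real_affine[of "\<lambda>y. f (Complex x y)" 1 "t * x"] by (simp add: add.commute)
  moreover have "Complex x y + \<i> * of_real (t * x) = Complex x (y + t * x)" for x y
    by (simp add: complex_eq_iff)
  ultimately show "(\<integral>\<^sup>+z. f (z + \<i> * of_real (t * Re z)) \<partial>lborel) = (\<integral>\<^sup>+z. f z \<partial>lborel)"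
    by (simp add: nn_integral_complex(1) del: of_real_mult)
qed

text \<open>A rotation other than by \<open>\<pi>\<close> is a product of three shears.\<close>
lemma nn_integral_rotation:
  assumes [measurable]: "f \<in> borel_measurable borel" and c: "cmod c = 1" "c \<noteq> -1"
  shows "(\<integral>\<^sup>+z. f (c * z) \<partial>lborel) = (\<integral>\<^sup>+z. f z \<partial>lborel)"
proof -
  \<comment> \<open>For \<open>c = cis \<theta>\<close> this is \<open>- tan (\<theta> / 2)\<close>;
    the middle shear has parameter \<open>sin \<theta>\<close>. Excluding \<open>c = -1\<close>
    keeps the denominator nonzero.\<close>
  define t where "t = - Im c / (1 + Re c)"
  define S where "S = (\<lambda>z. z + of_real (t * Im z))"
  define T where "T = (\<lambda>z. z + \<i> * of_real (Im c * Re z))"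
  have sq: "(Re c)\<^sup>2 + (Im c)\<^sup>2 = 1"
    using c by (simp add: cmod_def)
  have "1 + Re c \<noteq> 0"
  proof
    assume "1 + Re c = 0"
    then have "Re c = -1" by simp
    with sq have "Im c = 0" by simp
    with \<open>Re c = -1\<close> c(2) show False by (simp add: complex_eq_iff)
  qed
  have t1: "t * (1 + Re c) = - Im c"
    using \<open>1 + Re c \<noteq> 0\<close> by (simp add: t_def)
  have "(1 + Im c * t) * (1 + Re c) = 1 + Re c + Im c * (t * (1 + Re c))"
    by (simp add: algebra_simps)
  also have "\<dots> = Re c * (1 + Re c)"
    unfolding t1 using sq by (simp add: algebra_simps power2_eq_square)
  finally have t2: "1 + Im c * t = Re c"
    using \<open>1 + Re c \<noteq> 0\<close> by simp
  have STS: "c * z = S (T (S z))" for z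
  proof (rule complex_eqI)
    have *: "Im (T (S z)) = Im c * Re z + (1 + Im c * t) * Im z" "Re (T (S z)) = Re z + t * Im z"
      by (simp_all add: S_def T_def algebra_simps)
    show "Im (c * z) = Im (S (T (S z)))"
      using * t2 by (simp add: S_def)
    have "Re (S (T (S z))) = Re (T (S z)) + t * Im (T (S z))"
      by (simp add: S_def)
    also have "\<dots> = (1 + Im c * t) * Re z + t * (1 + (1 + Im c * t)) * Im z"
      unfolding * by (simp add: algebra_simps)
    finally have "Re (S (T (S z))) = Re c * Re z + (t * (1 + Re c)) * Im z"
      unfolding t2 .
    then show "Re (c * z) = Re (S (T (S z)))"
      unfolding t1 by simp
  qed
  have [measurable]: "S \<in> borel_measurable borel" "T \<in> borel_measurable borel"
    unfolding S_def T_def by measurable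
  have "(\<integral>\<^sup>+z. f (c * z) \<partial>lborel) = (\<integral>\<^sup>+z. f (S (T (S z))) \<partial>lborel)"
    by (simp add: STS)
  also have "\<dots> = (\<integral>\<^sup>+z. f (S (T z)) \<partial>lborel)"
    using nn_integral_shear(1)[of "\<lambda>z. f (S (T z))" t] by (simp add: S_def)
  also have "\<dots> = (\<integral>\<^sup>+z. f (S z) \<partial>lborel)"
    using nn_integral_shear(2)[of "\<lambda>z. f (S z)" "Im c"] by (simp add: T_def)
  also have "\<dots> = (\<integral>\<^sup>+z. f z \<partial>lborel)"
    using nn_integral_shear(1)[of f t] by (simp add: S_def)
  finally show ?thesis .
qed

lemma sets_dA [measurable_cong, simp]: "sets dA = sets borel"
  by (simp add: dA_def)

lemma space_dA [simp]: "space dA = UNIV"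
  by (simp add: dA_def)

lemma distr_dA_rotation:
  assumes c: "cmod c = 1" "c \<noteq> -1"
  shows "distr dA borel (\<lambda>z. c * z) = dA"
proof (rule measure_eqI)
  fix X assume "X \<in> sets (distr dA borel (\<lambda>z. c * z))"
  then have X [measurable]: "X \<in> sets borel" by simp
  have "emeasure (distr dA borel (\<lambda>z. c * z)) X =
      (\<integral>\<^sup>+z. ennreal (1 / pi) * indicator X (c * z) \<partial>lborel)"
    by (simp add: dA_def emeasure_distr emeasure_density indicator_def vimage_def)
  also have "\<dots> = (\<integral>\<^sup>+z. ennreal (1 / pi) * indicator X z \<partial>lborel)"
    by (rule nn_integral_rotation) (use c in auto)
  also have "\<dots> = emeasure dA X"
    by (simp add: dA_def emeasure_density)
  finally show "emeasure (distr dA borel (\<lambda>z. c * z)) X = emeasure dA X" .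
qed simp

section \<open>Distribution of the squared modulus\<close>

text \<open>Thanks to the factor \<open>1 / pi\<close>, the disc of squared radius \<open>a\<close>
  has measure \<open>a\<close>. The half-lines \<open>{..a}\<close> are stable under intersection
  and generate the Borel sets, so this determines the image measure.\<close>

lemma distr_dA_norm_square:
  "distr dA borel (\<lambda>z. (cmod z)\<^sup>2) = density lborel (indicator {0..})"
proof (rule measure_eqI_generator_eq[where E = "range atMost" and \<Omega> = UNIV
      and A = "\<lambda>i. {..real i}"])
  show "Int_stable (range (atMost :: real \<Rightarrow> _))"
    by (auto simp: Int_stable_def)
  have dist: "emeasure (distr dA borel (\<lambda>z. (cmod z)\<^sup>2)) {..a} = ennreal a" for a
  proof (cases "0 \<le> a")
    case True
    have "(\<lambda>z. (cmod z)\<^sup>2) -` {..a} = cball 0 (sqrt a)"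
      using True by (auto simp: real_le_rsqrt) (metis norm_ge_zero power_mono real_sqrt_pow2)
    then show ?thesis
      using True by (simp add: emeasure_distr dA_def emeasure_density nn_integral_cmult_indicator
          emeasure_cball unit_ball_vol_2 ennreal_mult[symmetric])
  next
    case False
    then have "(\<lambda>z. (cmod z)\<^sup>2) -` {..a} = {}"
      by (auto dest: order_trans[OF zero_le_power2])
    then show ?thesis
      using False by (simp add: emeasure_distr ennreal_neg)
  qed
  have dens: "emeasure (density lborel (indicator {0..})) {..a} = ennreal a" for a :: real
  proof -
    have "emeasure (density lborel (indicator {0..})) {..a} = emeasure lborel {0..a}"
      by (simp add: emeasure_density indicator_inter_arith[symmetric] atLeastAtMost_def Int_commute)
    also have "\<dots> = ennreal a"
      by (cases "0 \<le> a") (auto simp: ennreal_neg)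
    finally show ?thesis .
  qed
  show "emeasure (distr dA borel (\<lambda>z. (cmod z)\<^sup>2)) X = emeasure (density lborel (indicator {0..})) X"
    if "X \<in> range atMost" for X
    using that dist dens by auto
  show "emeasure (distr dA borel (\<lambda>z. (cmod z)\<^sup>2)) {..real i} \<noteq> \<infinity>" for i
    by (simp add: dist)
  show "(\<Union>i. {..real i}) = UNIV"
    by (auto intro: real_arch_simple)
  show "sets (distr dA borel (\<lambda>z. (cmod z)\<^sup>2)) = sigma_sets UNIV (range atMost)"
    "sets (density lborel (indicator {0..} :: real \<Rightarrow> _)) = sigma_sets UNIV (range atMost)"
    by (auto simp: borel_eq_atMost)
qed auto

lemma nn_integral_dA_radial:
  assumes [measurable]: "h \<in> borel_measurable borel"
  shows "(\<integral>\<^sup>+z. h ((cmod z)\<^sup>2) \<partial>dA) = (\<integral>\<^sup>+t. indicator {0..} t * h t \<partial>lborel)"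
proof -
  have "(\<integral>\<^sup>+z. h ((cmod z)\<^sup>2) \<partial>dA) = (\<integral>\<^sup>+t. h t \<partial>distr dA borel (\<lambda>z. (cmod z)\<^sup>2))"
    by (subst nn_integral_distr) auto
  then show ?thesis
    by (simp add: distr_dA_norm_square nn_integral_density)
qed

subsection \<open>Orthogonality of monomials\<close>

lemma integrable_gauss: "integrable dA (\<lambda>z. exp (- (cmod z)\<^sup>2))"
proof (rule integrableI_nonneg)
  have "(\<integral>\<^sup>+z. ennreal (exp (- (cmod z)\<^sup>2)) \<partial>dA) = (\<integral>\<^sup>+t. indicator {0..} t * ennreal (exp (- t)) \<partial>lborel)"
    by (rule nn_integral_dA_radial) auto
  also have "\<dots> = (\<integral>\<^sup>+t. ennreal (exp (- t)) * indicator {0..} t \<partial>lborel)"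
    by (simp add: mult.commute)
  also have "\<dots> = ennreal (0 - (- exp (- 0)))"
  proof (rule nn_integral_FTC_atLeast)
    show "((\<lambda>t. - exp (- t)) \<longlongrightarrow> (0::real)) at_top"
      by real_asymp
  qed (auto intro!: derivative_eq_intros)
  finally show "(\<integral>\<^sup>+z. ennreal (exp (- (cmod z)\<^sup>2)) \<partial>dA) < \<infinity>"
    by simp
qed auto

text \<open>Follows from \<open>(1 + x / m) ^ m \<le> exp x\<close> at \<open>x = r\<^sup>2\<close>.
  The weight \<open>exp (- 2 * r\<^sup>2)\<close> has two Gaussian factors: one absorbs the power
  here, the other ensures integrability.\<close>

lemma power_mult_gauss_le:
  fixes r :: real
  assumes "0 \<le> r"
  shows "r ^ m * exp (- r\<^sup>2) \<le> 1 + real m ^ m"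
proof -
  have a: "(r\<^sup>2) ^ m \<le> real m ^ m * exp (r\<^sup>2)"
  proof (cases "m = 0")
    case False
    have "(r\<^sup>2) ^ m = real m ^ m * (r\<^sup>2 / real m) ^ m"
      using False by (simp add: power_divide)
    also have "\<dots> \<le> real m ^ m * (1 + r\<^sup>2 / real m) ^ m"
      by (intro mult_left_mono power_mono) auto
    also have "\<dots> \<le> real m ^ m * exp (r\<^sup>2)"
      using False by (intro mult_left_mono exp_ge_one_plus_x_over_n_power_n)
        (auto intro: order_trans[OF _ zero_le_power2])
    finally show ?thesis .
  qed simp
  \<comment> \<open>Passing to the square costs at most the summand 1 and produces a power of
    \<open>r\<^sup>2\<close>, to which the exponential bound applies.\<close>
  have "r ^ m \<le> 1 + (r ^ m)\<^sup>2"
    using sum_squares_bound[of 1 "r ^ m"] zero_le_power[OF assms, of m] by simp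
  also have "\<dots> \<le> exp (r\<^sup>2) + real m ^ m * exp (r\<^sup>2)"
    using a by (intro add_mono) (simp_all add: power_mult[symmetric] mult.commute)
  finally have "r ^ m \<le> (1 + real m ^ m) * exp (r\<^sup>2)"
    by (simp add: algebra_simps)
  then show ?thesis
    by (simp add: exp_minus field_simps)
qed

lemma integrable_power_gauss:
  "integrable dA (\<lambda>z. (cmod z) ^ m * exp (- 2 * (cmod z)\<^sup>2))"
proof (rule Bochner_Integration.integrable_bound)
  show "integrable dA (\<lambda>z. (1 + real m ^ m) * exp (- (cmod z)\<^sup>2))"
    by (intro integrable_mult_right integrable_gauss)
  show "AE z in dA. norm ((cmod z) ^ m * exp (- 2 * (cmod z)\<^sup>2)) \<le> norm ((1 + real m ^ m) * exp (- (cmod z)\<^sup>2))"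
  proof (rule AE_I2)
    fix z
    have "(cmod z) ^ m * exp (- 2 * (cmod z)\<^sup>2) = (cmod z) ^ m * exp (- (cmod z)\<^sup>2) * exp (- (cmod z)\<^sup>2)"
      by (simp add: exp_add[symmetric])
    also have "\<dots> \<le> (1 + real m ^ m) * exp (- (cmod z)\<^sup>2)"
      by (intro mult_right_mono power_mult_gauss_le) auto
    finally show "norm ((cmod z) ^ m * exp (- 2 * (cmod z)\<^sup>2)) \<le> norm ((1 + real m ^ m) * exp (- (cmod z)\<^sup>2))"
      by simp
  qed
qed auto

text \<open>In what follows a rotation invariant set is given by the set \<open>B\<close> of the squared moduli of its
  points.\<close>
definition gauss_moment :: "real set \<Rightarrow> nat \<Rightarrow> real" where
  "gauss_moment B k =
    (LINT z|dA. indicator B ((cmod z)\<^sup>2) * (cmod z) ^ (2 * k) * exp (- 2 * (cmod z)\<^sup>2))"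

definition wmod :: "complex poly \<Rightarrow> complex \<Rightarrow> real" where
  "wmod p z = cmod (poly p z) * exp (- (cmod z)\<^sup>2)"

definition gauss_mass :: "complex poly \<Rightarrow> real set \<Rightarrow> real" where
  "gauss_mass p B = (LINT z|dA. indicator B ((cmod z)\<^sup>2) * (wmod p z)\<^sup>2)"

lemma integrable_monomials:
  assumes [measurable]: "B \<in> sets borel"
  shows "integrable dA (\<lambda>z. indicator B ((cmod z)\<^sup>2) *\<^sub>R (z ^ j * cnj z ^ k * of_real (exp (- 2 * (cmod z)\<^sup>2))))"
proof (rule Bochner_Integration.integrable_bound[OF integrable_power_gauss[of "j + k"]])
  have [measurable]: "cnj \<in> borel_measurable borel"
    by (intro borel_measurable_continuous_onI continuous_intros)
  show "(\<lambda>z. indicator B ((cmod z)\<^sup>2) *\<^sub>R (z ^ j * cnj z ^ k * of_real (exp (- 2 * (cmod z)\<^sup>2))))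
      \<in> borel_measurable dA"
    by measurable
qed (auto simp: norm_mult norm_power power_add indicator_def intro!: AE_I2)

text \<open>Rotating by \<open>\<pi> / (2m)\<close>, where \<open>m\<close> is the difference of the exponents, multiplies the
  integral by \<open>\<plusminus>\<i>\<close>, so it vanishes.\<close>
lemma monomials_orthogonal:
  assumes [measurable]: "B \<in> sets borel" and "j \<noteq> k"
  shows "(LINT z|dA. indicator B ((cmod z)\<^sup>2) *\<^sub>R (z ^ j * cnj z ^ k * of_real (exp (- 2 * (cmod z)\<^sup>2)))) = 0"
proof -
  define m where "m = real j - real k"
  define \<theta> where "\<theta> = pi / (2 * m)"
  define F where "F = (\<lambda>z. indicator B ((cmod z)\<^sup>2) *\<^sub>R (z ^ j * cnj z ^ k * of_real (exp (- 2 * (cmod z)\<^sup>2))))"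
  have m: "m \<noteq> 0" "1 \<le> \<bar>m\<bar>"
    using \<open>j \<noteq> k\<close> by (auto simp: m_def)
  have [measurable]: "cnj \<in> borel_measurable borel"
    by (intro borel_measurable_continuous_onI continuous_intros)
  have [measurable]: "F \<in> borel_measurable borel"
    unfolding F_def by measurable
  \<comment> \<open>The exponents differ by at least 1, so the angle is at most a right angle and
    the rotation by \<open>pi\<close>, excluded in \<open>distr_dA_rotation\<close>, does not
    occur.\<close>
  have "\<bar>\<theta>\<bar> \<le> pi / 2"
    using m by (simp add: \<theta>_def abs_mult field_simps)
  then have "0 \<le> cos \<theta>"
    by (intro cos_ge_zero) auto
  then have c: "cis \<theta> \<noteq> -1"
    by (metis cis.sel(1) one_complex.sel(1) uminus_complex.sel(1) not_one_le_zero neg_0_le_iff_le)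
  have "cis \<theta> ^ j * cnj (cis \<theta>) ^ k = cis (real j * \<theta> - real k * \<theta>)"
    by (simp add: cis_cnj Complex.DeMoivre cis_mult)
  also have "real j * \<theta> - real k * \<theta> = m * \<theta>"
    by (simp add: m_def algebra_simps)
  also have "m * \<theta> = pi / 2"
    using m(1) by (simp add: \<theta>_def)
  finally have rot: "cis \<theta> ^ j * cnj (cis \<theta>) ^ k = \<i>"
    by simp
  have "F (cis \<theta> * z) = (cis \<theta> ^ j * cnj (cis \<theta>) ^ k) * F z" for z
    by (simp add: F_def norm_mult power_mult_distrib)
  then have F: "F (cis \<theta> * z) = \<i> * F z" for z
    by (simp only: rot)
  have "(LINT z|dA. F z) = (LINT z|distr dA borel (\<lambda>z. cis \<theta> * z). F z)"
    using c by (simp add: distr_dA_rotation)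
  also have "\<dots> = (LINT z|dA. F (cis \<theta> * z))"
    by (subst integral_distr) auto
  also have "\<dots> = \<i> * (LINT z|dA. F z)"
    by (simp add: F)
  finally have "(1 - \<i>) * (LINT z|dA. F z) = 0"
    by (simp add: algebra_simps)
  moreover have "1 - \<i> \<noteq> 0"
    by (simp add: complex_eq_iff)
  ultimately show ?thesis
    by (simp add: F_def)
qed

lemma indicator_wmod_square:
  assumes "degree p \<le> d"
  shows "of_real (indicator B ((cmod z)\<^sup>2) * (wmod p z)\<^sup>2) =
    (\<Sum>j\<le>d. \<Sum>k\<le>d. coeff p j * cnj (coeff p k) *
      (indicator B ((cmod z)\<^sup>2) *\<^sub>R (z ^ j * cnj z ^ k * of_real (exp (- 2 * (cmod z)\<^sup>2)))))"
proof -
  have p: "poly p z = (\<Sum>k\<le>d. coeff p k * z ^ k)"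
    unfolding poly_altdef using assms
    by (intro sum.mono_neutral_left) (auto simp: coeff_eq_0)
  have e: "(exp (- (cmod z)\<^sup>2))\<^sup>2 = exp (- 2 * (cmod z)\<^sup>2)"
    by (simp add: power2_eq_square exp_add[symmetric])
  have "of_real (indicator B ((cmod z)\<^sup>2) * (wmod p z)\<^sup>2) =
      indicator B ((cmod z)\<^sup>2) *\<^sub>R (poly p z * cnj (poly p z) * of_real (exp (- 2 * (cmod z)\<^sup>2)))"
    unfolding wmod_def power_mult_distrib e
    by (simp add: scaleR_conv_of_real complex_norm_square[symmetric])
  also have "poly p z * cnj (poly p z) = (\<Sum>j\<le>d. \<Sum>k\<le>d. (coeff p j * z ^ j) * (cnj (coeff p k) * cnj z ^ k))"
    unfolding p by (simp add: sum_product)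
  finally show ?thesis
    by (simp add: sum_distrib_left sum_distrib_right scaleR_conv_of_real mult_ac)
qed

lemma integrable_wmod_square:
  assumes [measurable]: "B \<in> sets borel"
  shows "integrable dA (\<lambda>z. indicator B ((cmod z)\<^sup>2) * (wmod p z)\<^sup>2)"
proof -
  have "integrable dA (\<lambda>z. complex_of_real (indicator B ((cmod z)\<^sup>2) * (wmod p z)\<^sup>2))"
    unfolding indicator_wmod_square[OF order_refl]
    by (intro Bochner_Integration.integrable_sum integrable_mult_right integrable_monomials assms)
  then show ?thesis
    by (simp only: complex_of_real_integrable_eq)
qed

text \<open>Parseval: the off-diagonal terms vanish by orthogonality. The bound \<open>d\<close> is
  kept free so that a polynomial, its cut-off and the discarded tail can be summed over the same
  range.\<close>

lemma gauss_mass_eq_sum: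
  assumes [measurable]: "B \<in> sets borel" and d: "degree p \<le> d"
  shows "gauss_mass p B = (\<Sum>k\<le>d. (cmod (coeff p k))\<^sup>2 * gauss_moment B k)"
proof -
  define E where "E = (\<lambda>j k z. indicator B ((cmod z)\<^sup>2) *\<^sub>R (z ^ j * cnj z ^ k * of_real (exp (- 2 * (cmod z)\<^sup>2))))"
  have int: "integrable dA (E j k)" for j k
    unfolding E_def by (rule integrable_monomials) simp
  have E: "(LINT z|dA. E j k z) = (if j = k then of_real (gauss_moment B k) else 0)" for j k
  proof (cases "j = k")
    case True
    have "E k k z = of_real (indicator B ((cmod z)\<^sup>2) * (cmod z) ^ (2 * k) * exp (- 2 * (cmod z)\<^sup>2))" for z
    proof -
      have "z ^ k * cnj z ^ k = of_real ((cmod z) ^ (2 * k))"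
        by (simp add: power_mult_distrib[symmetric] complex_norm_square[symmetric] power_mult)
      then show ?thesis
        by (simp add: E_def scaleR_conv_of_real)
    qed
    then show ?thesis
      using True by (simp only: gauss_moment_def integral_complex_of_real simp_thms if_True)
  qed (use monomials_orthogonal[of B j k] in \<open>simp add: E_def\<close>)
  have "of_real (gauss_mass p B) = (LINT z|dA. (\<Sum>j\<le>d. \<Sum>k\<le>d. coeff p j * cnj (coeff p k) * E j k z))"
    unfolding gauss_mass_def E_def
    by (simp only: integral_complex_of_real[symmetric] indicator_wmod_square[OF d])
  also have "\<dots> = (\<Sum>j\<le>d. \<Sum>k\<le>d. coeff p j * cnj (coeff p k) * (LINT z|dA. E j k z))"
    using int by simp
  also have "\<dots> = of_real (\<Sum>k\<le>d. (cmod (coeff p k))\<^sup>2 * gauss_moment B k)"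
    by (simp add: E if_distrib sum.delta complex_norm_square[symmetric] cong: if_cong)
  finally show ?thesis
    by (simp only: of_real_eq_iff)
qed

subsection \<open>Gaussian moments of discs and annuli\<close>

text \<open>The difference of the two sides vanishes at 0 and has derivative
  \<open>x\<^sup>2 / (1 + x)\<close>, so its monotonicity yields both inequalities.\<close>

lemma ln_taylor2:
  fixes x :: real
  shows "0 \<le> x \<Longrightarrow> x - x\<^sup>2 / 2 \<le> ln (1 + x)"
    and "-1 < x \<Longrightarrow> x \<le> 0 \<Longrightarrow> ln (1 + x) \<le> x - x\<^sup>2 / 2"
proof -
  define F :: "real \<Rightarrow> real" where "F = (\<lambda>x. ln (1 + x) - x + x\<^sup>2 / 2)"
  have F': "\<exists>y. (F has_real_derivative y) (at x) \<and> 0 \<le> y" if "-1 < x" for x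
  proof (intro exI conjI)
    have "1 / (1 + x) - 1 + x = x\<^sup>2 / (1 + x)"
      using that by (simp add: field_simps power2_eq_square)
    then show "(F has_real_derivative x\<^sup>2 / (1 + x)) (at x)"
      unfolding F_def using that by (auto intro!: derivative_eq_intros)
  qed (use that in auto)
  have mono: "F a \<le> F b" if "-1 < a" "a \<le> b" for a b
    using that by (intro DERIV_nonneg_imp_nondecreasing[of a b F]) (auto intro: F')
  show "0 \<le> x \<Longrightarrow> x - x\<^sup>2 / 2 \<le> ln (1 + x)"
    using mono[of 0 x] by (simp add: F_def)
  show "-1 < x \<Longrightarrow> x \<le> 0 \<Longrightarrow> ln (1 + x) \<le> x - x\<^sup>2 / 2"
    using mono[of x 0] by (simp add: F_def)
qed

lemma gauss_moment_nonneg [simp]: "0 \<le> gauss_moment B k"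
  by (auto simp: gauss_moment_def intro!: integral_nonneg_AE)

lemma integrable_gauss_moment:
  assumes [measurable]: "B \<in> sets borel"
  shows "integrable dA (\<lambda>z. indicator B ((cmod z)\<^sup>2) * (cmod z) ^ (2 * k) * exp (- 2 * (cmod z)\<^sup>2))"
  by (rule Bochner_Integration.integrable_bound[OF integrable_power_gauss[of "2 * k"]])
    (auto simp: indicator_def intro!: AE_I2)

lemma gauss_moment_eq_nn_integral:
  assumes [measurable]: "B \<in> sets borel"
  shows "ennreal (gauss_moment B k) = (\<integral>\<^sup>+t. indicator ({0..} \<inter> B) t * ennreal (t ^ k * exp (- 2 * t)) \<partial>lborel)"
proof -
  have "ennreal (gauss_moment B k) =
      (\<integral>\<^sup>+z. ennreal (indicator B ((cmod z)\<^sup>2) * (cmod z) ^ (2 * k) * exp (- 2 * (cmod z)\<^sup>2)) \<partial>dA)"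
    unfolding gauss_moment_def using integrable_gauss_moment[OF assms, of k]
    by (intro nn_integral_eq_integral[symmetric]) auto
  also have "\<dots> = (\<integral>\<^sup>+z. (\<lambda>t. indicator B t * ennreal (t ^ k * exp (- 2 * t))) ((cmod z)\<^sup>2) \<partial>dA)"
    by (intro nn_integral_cong) (auto simp: indicator_def power_mult)
  also have "\<dots> = (\<integral>\<^sup>+t. indicator {0..} t * (indicator B t * ennreal (t ^ k * exp (- 2 * t))) \<partial>lborel)"
    by (rule nn_integral_dA_radial) measurable
  finally show ?thesis
    by (simp add: indicator_inter_arith mult.assoc)
qed

text \<open>The next two bounds compare \<open>k ln t - 2 t\<close> with its second-order expansion at \<open>t = s\<close>; for
  \<open>k = 2 s\<close> the linear term vanishes there, and a larger \<open>k\<close> only helps.\<close>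
lemma power_exp_lower:
  fixes s t h :: real
  assumes "0 < s" "2 * s \<le> real k" "s \<le> t" "t \<le> s + h" "h\<^sup>2 \<le> 2 * s"
  shows "exp (- 2) * (s ^ k * exp (- 2 * s)) \<le> t ^ k * exp (- 2 * t)"
proof -
  define x where "x = (t - s) / s"
  have x: "0 \<le> x" "t = s * (1 + x)" "s * x = t - s"
    using assms by (auto simp: x_def field_simps)
  have "s * x\<^sup>2 = (t - s)\<^sup>2 / s"
    using assms by (simp add: x_def power2_eq_square)
  also have "\<dots> \<le> h\<^sup>2 / s"
    using assms by (intro divide_right_mono power_mono) auto
  also have "\<dots> \<le> 2"
    using assms by (simp add: field_simps)
  finally have sx: "s * x\<^sup>2 \<le> 2" .
  have "2 * s * (x - x\<^sup>2 / 2) \<le> 2 * s * ln (1 + x)"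
    using assms x by (intro mult_left_mono ln_taylor2) auto
  also have "\<dots> \<le> real k * ln (1 + x)"
    using assms x by (intro mult_right_mono) auto
  \<comment> \<open>The linear term \<open>2 * s * x = 2 * (t - s)\<close> offsets the change of
    \<open>exp (- 2 * t)\<close> between \<open>s\<close> and \<open>t\<close>. The quadratic loss
    \<open>s * x\<^sup>2\<close> is at most 2, whence the factor \<open>exp (- 2)\<close>.\<close>
  finally have "- 2 + 2 * (t - s) \<le> real k * ln (1 + x)"
    using sx x(3) by (simp add: algebra_simps)
  then have "exp (- 2 + 2 * (t - s)) \<le> exp (real k * ln (1 + x))"
    by simp
  also have "\<dots> = (1 + x) ^ k"
    using x by (simp add: exp_of_nat_mult)
  finally have "s ^ k * exp (- 2 * t) * exp (- 2 + 2 * (t - s)) \<le> s ^ k * exp (- 2 * t) * (1 + x) ^ k"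
    using assms by (intro mult_left_mono) auto
  also have "\<dots> = t ^ k * exp (- 2 * t)"
    by (simp add: x(2) power_mult_distrib)
  also have "s ^ k * exp (- 2 * t) * exp (- 2 + 2 * (t - s)) = exp (- 2) * (s ^ k * exp (- 2 * s))"
    by (simp add: exp_add[symmetric])
  finally show ?thesis .
qed

lemma power_exp_upper:
  fixes s t :: real
  assumes "0 < s" "2 * s \<le> real k" "0 \<le> t" "t \<le> s"
  shows "t ^ k * exp (- 2 * t) \<le> exp 1 * (s ^ k * exp (- 2 * s)) * exp ((t - s) / sqrt s)"
\<comment> \<open>At \<open>t = 0\<close> the logarithm below would be taken at 0; there
  \<open>k > 0\<close> and the left side vanishes.\<close>
proof (cases "t = 0")
  case True
  then show ?thesis
    using assms by (cases k) auto
next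
  case False
  define x where "x = (t - s) / s"
  have x: "-1 < x" "x \<le> 0" "t = s * (1 + x)" "s * x = t - s"
    using assms False by (auto simp: x_def field_simps)
  have "real k * ln (1 + x) \<le> 2 * s * ln (1 + x)"
    using assms x by (intro mult_right_mono_neg) auto
  also have "\<dots> \<le> 2 * s * (x - x\<^sup>2 / 2)"
    using assms x by (intro mult_left_mono ln_taylor2) auto
  also have "\<dots> = 2 * (s * x) - s * x\<^sup>2"
    by (simp add: right_diff_distrib)
  also have "\<dots> = 2 * (t - s) - (sqrt s * x)\<^sup>2"
    using assms x(4) by (simp add: power_mult_distrib)
  \<comment> \<open>With \<open>y = sqrt s * x\<close>, the bound
    \<open>- y\<^sup>2 \<le> 1 + y\<close> weakens Gaussian decay to exponential decay, which has an
    elementary antiderivative.\<close>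
  also have "\<dots> \<le> 2 * (t - s) + 1 + sqrt s * x"
  proof -
    have "0 \<le> (sqrt s * x + 1 / 2)\<^sup>2"
      by (rule zero_le_power2)
    then show ?thesis
      unfolding power2_sum by (simp add: power_divide)
  qed
  also have "sqrt s * x = (t - s) / sqrt s"
    using assms by (simp add: x_def field_simps)
  finally have "exp (real k * ln (1 + x)) \<le> exp (2 * (t - s) + 1 + (t - s) / sqrt s)"
    by simp
  moreover have "exp (real k * ln (1 + x)) = (1 + x) ^ k"
    using x by (simp add: exp_of_nat_mult)
  ultimately have le: "(1 + x) ^ k \<le> exp (2 * (t - s) + 1 + (t - s) / sqrt s)"
    by simp
  have "t ^ k * exp (- 2 * t) = s ^ k * exp (- 2 * t) * (1 + x) ^ k"
    by (simp add: x(3) power_mult_distrib)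
  also have "\<dots> \<le> s ^ k * exp (- 2 * t) * exp (2 * (t - s) + 1 + (t - s) / sqrt s)"
    using le assms by (intro mult_left_mono) auto
  also have "\<dots> = exp 1 * (s ^ k * exp (- 2 * s)) * exp ((t - s) / sqrt s)"
    by (simp add: exp_add[symmetric] mult.assoc)
  finally show ?thesis .
qed

text \<open>With \<open>c = s ^ k * exp (- 2 * s)\<close>, the disc moment is at most
  \<open>exp 1 * c * sqrt s\<close> by integrating the exponential bound, and the annulus moment is
  at least \<open>exp (- 2) * c * h\<close>. As \<open>sqrt s \<le> h\<close>, the quotient is at
  most \<open>exp 3\<close>.\<close>

lemma gauss_moment_disc_le_annulus:
  assumes s: "0 < s" and k: "2 * s \<le> real k" and h: "0 \<le> h" "s \<le> h\<^sup>2" "h\<^sup>2 \<le> 2 * s"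
  shows "gauss_moment {0..<s} k \<le> exp 3 * gauss_moment {s..<s + h} k"
proof -
  define c where "c = s ^ k * exp (- 2 * s)"
  have c: "0 \<le> c"
    using s by (simp add: c_def)
  have sh: "sqrt s \<le> h"
    using h by (simp add: real_le_lsqrt)
  have "ennreal (gauss_moment {0..<s} k) =
      (\<integral>\<^sup>+t. indicator ({0..} \<inter> {0..<s}) t * ennreal (t ^ k * exp (- 2 * t)) \<partial>lborel)"
    by (rule gauss_moment_eq_nn_integral) simp
  also have "\<dots> \<le> (\<integral>\<^sup>+t. ennreal (exp 1 * c * exp ((t - s) / sqrt s)) * indicator {0..s} t \<partial>lborel)"
    using power_exp_upper[OF s k] by (intro nn_integral_mono) (auto simp: indicator_def c_def intro!: ennreal_leI)
  also have "\<dots> = ennreal (exp 1 * c * sqrt s * exp ((s - s) / sqrt s) - exp 1 * c * sqrt s * exp ((0 - s) / sqrt s))"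
  proof (intro nn_integral_FTC_Icc)
    fix t
    define r where "r = sqrt s"
    have "r > 0"
      using s by (simp add: r_def)
    then show "((\<lambda>t. exp 1 * c * sqrt s * exp ((t - s) / sqrt s)) has_real_derivative
        exp 1 * c * exp ((t - s) / sqrt s)) (at t)"
      unfolding r_def[symmetric] by (auto intro!: derivative_eq_intros)
  qed (use s c in auto)
  also have "\<dots> \<le> ennreal (exp 1 * c * h)"
    using c s by (intro ennreal_leI order_trans[OF _ mult_left_mono[OF sh]]) auto
  finally have up: "gauss_moment {0..<s} k \<le> exp 1 * c * h"
    using c h by (simp add: ennreal_le_iff)
  have "ennreal (exp (- 2) * c * h) = (\<integral>\<^sup>+t. ennreal (exp (- 2) * c) * indicator {s..<s + h} t \<partial>lborel)"
    using h c by (simp add: nn_integral_cmult_indicator ennreal_mult)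
  also have "\<dots> \<le> (\<integral>\<^sup>+t. indicator ({0..} \<inter> {s..<s + h}) t * ennreal (t ^ k * exp (- 2 * t)) \<partial>lborel)"
    using power_exp_lower[OF s k _ _ h(3)] s
    by (intro nn_integral_mono) (auto simp: indicator_def c_def intro!: ennreal_leI)
  also have "\<dots> = ennreal (gauss_moment {s..<s + h} k)"
    by (rule gauss_moment_eq_nn_integral[symmetric]) simp
  finally have lo: "exp (- 2) * c * h \<le> gauss_moment {s..<s + h} k"
    by (simp add: ennreal_le_iff)
  have "exp 1 * c * h = exp 3 * (exp (- 2) * c * h)"
    by (simp add: exp_add[symmetric] mult.assoc[symmetric])
  also have "\<dots> \<le> exp 3 * gauss_moment {s..<s + h} k"
    using lo by (intro mult_left_mono) auto
  finally show ?thesis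
    using up by simp
qed

subsection \<open>Mass and defect of a polynomial\<close>

lemma wmod_nonneg [simp]: "0 \<le> wmod p z"
  by (simp add: wmod_def)

lemma wmod_0 [simp]: "wmod 0 z = 0"
  by (simp add: wmod_def)

lemma borel_measurable_wmod [measurable]: "wmod p \<in> borel_measurable borel"
  unfolding wmod_def by (intro borel_measurable_continuous_onI continuous_intros)

lemma wmod_diff_le: "\<bar>wmod q z - wmod p z\<bar> \<le> wmod (p - q) z"
proof -
  have "\<bar>wmod q z - wmod p z\<bar> = \<bar>cmod (poly q z) - cmod (poly p z)\<bar> * exp (- (cmod z)\<^sup>2)"
    by (simp add: wmod_def abs_mult left_diff_distrib[symmetric])
  also have "\<dots> \<le> wmod (p - q) z"
    unfolding wmod_def poly_diff
    by (intro mult_right_mono) (auto simp: norm_minus_commute intro: order_trans[OF norm_triangle_ineq3])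
  finally show ?thesis .
qed

lemma gauss_mass_nonneg [simp]: "0 \<le> gauss_mass p B"
  unfolding gauss_mass_def by (intro integral_nonneg_AE AE_I2) auto

lemma gauss_mass_0 [simp]: "gauss_mass 0 B = 0"
  by (simp add: gauss_mass_def)

lemma gauss_mass_Un:
  assumes [measurable]: "A \<in> sets borel" "B \<in> sets borel" and "A \<inter> B = {}"
  shows "gauss_mass p (A \<union> B) = gauss_mass p A + gauss_mass p B"
  unfolding gauss_mass_def using assms
  by (subst Bochner_Integration.integral_add[symmetric])
    (intro integrable_wmod_square Bochner_Integration.integral_cong; auto simp: indicator_def)+

lemma integral_annulus:
  assumes "0 \<le> a" "a \<le> b"
  shows "integrable dA (\<lambda>z. indicator {a..<b} ((cmod z)\<^sup>2) :: real)"
    and "(LINT z|dA. indicator {a..<b} ((cmod z)\<^sup>2)) = b - a"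
proof -
  have "(\<integral>\<^sup>+z. ennreal (indicator {a..<b} ((cmod z)\<^sup>2)) \<partial>dA) =
      (\<integral>\<^sup>+t. indicator {0..} t * ennreal (indicator {a..<b} t) \<partial>lborel)"
    by (rule nn_integral_dA_radial) auto
  also have "\<dots> = (\<integral>\<^sup>+t. indicator {a..<b} t \<partial>lborel)"
    using assms by (intro nn_integral_cong) (auto simp: indicator_def)
  also have "\<dots> = ennreal (b - a)"
    using assms by simp
  finally have *: "(\<integral>\<^sup>+z. ennreal (indicator {a..<b} ((cmod z)\<^sup>2)) \<partial>dA) = ennreal (b - a)" .
  show "integrable dA (\<lambda>z. indicator {a..<b} ((cmod z)\<^sup>2) :: real)"
    by (rule integrableI_nonneg) (auto simp: *)
  show "(LINT z|dA. indicator {a..<b} ((cmod z)\<^sup>2)) = b - a"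
    by (rule integral_eq_nn_integral[THEN trans]) (use assms in \<open>auto simp: *\<close>)
qed

section \<open>Quadratic inequalities for the defect\<close>

text \<open>A weighted Young inequality: a small \<eta> leaves the main term \<open>x\<close> almost
  unchanged, at the price of a large factor on the error term \<open>y\<close>.\<close>

lemma square_add_le:
  fixes x y \<eta> :: real
  assumes "0 < \<eta>"
  shows "(x + y)\<^sup>2 \<le> (1 + \<eta>) * x\<^sup>2 + (1 + 1 / \<eta>) * y\<^sup>2"
proof -
  have "0 \<le> (sqrt \<eta> * x - y / sqrt \<eta>)\<^sup>2"
    by simp
  also have "\<dots> = \<eta> * x\<^sup>2 - 2 * x * y + y\<^sup>2 / \<eta>"
    using assms by (simp add: power2_diff power_mult_distrib power_divide)
  finally show ?thesis
    by (simp add: power2_sum algebra_simps)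
qed

text \<open>The disc part of the functional before division by \<open>R\<^sup>2\<close>, on a
  general set of squared moduli so that it can be split at an intermediate radius.\<close>

definition defect :: "complex poly \<Rightarrow> real set \<Rightarrow> real" where
  "defect p B = (LINT z|dA. indicator B ((cmod z)\<^sup>2) * (wmod p z - 1)\<^sup>2)"

lemma defect_nonneg [simp]: "0 \<le> defect p B"
  unfolding defect_def by (intro integral_nonneg_AE AE_I2) auto

lemma integrable_defect:
  assumes "0 \<le> a" "a \<le> b"
  shows "integrable dA (\<lambda>z. indicator {a..<b} ((cmod z)\<^sup>2) * (wmod p z - 1)\<^sup>2)"
proof (rule Bochner_Integration.integrable_bound)
  show "integrable dA (\<lambda>z. 2 * (indicator {a..<b} ((cmod z)\<^sup>2) * (wmod p z)\<^sup>2)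
      + 2 * indicator {a..<b} ((cmod z)\<^sup>2))"
    using integral_annulus(1)[OF assms]
    by (intro Bochner_Integration.integrable_add integrable_mult_right integrable_wmod_square) auto
  show "AE z in dA. norm (indicator {a..<b} ((cmod z)\<^sup>2) * (wmod p z - 1)\<^sup>2)
      \<le> norm (2 * (indicator {a..<b} ((cmod z)\<^sup>2) * (wmod p z)\<^sup>2) + 2 * indicator {a..<b} ((cmod z)\<^sup>2))"
    using square_add_le[of 1 "wmod p _" "-1"] by (intro AE_I2) (auto simp: indicator_def)
qed auto

lemma defect_split:
  assumes "0 \<le> a" "a \<le> b" "b \<le> c"
  shows "defect p {a..<c} = defect p {a..<b} + defect p {b..<c}"
  unfolding defect_def using assms
  by (subst Bochner_Integration.integral_add[symmetric])
    (intro integrable_defect Bochner_Integration.integral_cong; auto simp: indicator_def)+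

lemma defect_0: "0 \<le> a \<Longrightarrow> a \<le> b \<Longrightarrow> defect 0 {a..<b} = b - a"
  by (simp add: defect_def integral_annulus)

text \<open>Write the weighted modulus as its deviation from 1 plus 1; the constant contributes the
  area \<open>b - a\<close>. With \<open>\<eta> = 1\<close> this bounds the mass in the whole disc,
  with small \<eta> the mass in a thin annulus.\<close>

lemma gauss_mass_le_defect:
  assumes "0 \<le> a" "a \<le> b" "0 < \<eta>"
  shows "gauss_mass p {a..<b} \<le> (1 + \<eta>) * defect p {a..<b} + (1 + 1 / \<eta>) * (b - a)"
proof -
  have "gauss_mass p {a..<b} \<le> (LINT z|dA. (1 + \<eta>) * (indicator {a..<b} ((cmod z)\<^sup>2) * (wmod p z - 1)\<^sup>2)
      + (1 + 1 / \<eta>) * indicator {a..<b} ((cmod z)\<^sup>2))"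
    unfolding gauss_mass_def
  proof (rule integral_mono)
    show "indicator {a..<b} ((cmod z)\<^sup>2) * (wmod p z)\<^sup>2
        \<le> (1 + \<eta>) * (indicator {a..<b} ((cmod z)\<^sup>2) * (wmod p z - 1)\<^sup>2)
          + (1 + 1 / \<eta>) * indicator {a..<b} ((cmod z)\<^sup>2)" for z
      using square_add_le[OF \<open>0 < \<eta>\<close>, of "wmod p z - 1" 1] by (auto simp: indicator_def)
  qed (use assms in \<open>auto intro!: integrable_wmod_square integrable_defect integral_annulus\<close>)
  also have "\<dots> = (1 + \<eta>) * defect p {a..<b} + (1 + 1 / \<eta>) * (b - a)"
    using integrable_defect[of a b p] integral_annulus[of a b] assms
    by (subst Bochner_Integration.integral_add) (auto simp: defect_def)
  finally show ?thesis .
qed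

text \<open>The reverse triangle inequality bounds the change of the weighted modulus by that of
  \<open>p - q\<close>, which enters as the error term of \<open>square_add_le\<close>.\<close>

lemma defect_perturb:
  assumes "0 \<le> a" "a \<le> b" "0 < \<eta>"
  shows "defect q {a..<b} \<le> (1 + \<eta>) * defect p {a..<b} + (1 + 1 / \<eta>) * gauss_mass (p - q) {a..<b}"
proof -
  have int: "integrable dA (\<lambda>z. indicator {a..<b} ((cmod z)\<^sup>2) * (wmod (p - q) z)\<^sup>2)"
    by (rule integrable_wmod_square) simp
  have "defect q {a..<b} \<le> (LINT z|dA. (1 + \<eta>) * (indicator {a..<b} ((cmod z)\<^sup>2) * (wmod p z - 1)\<^sup>2)
      + (1 + 1 / \<eta>) * (indicator {a..<b} ((cmod z)\<^sup>2) * (wmod (p - q) z)\<^sup>2))"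
    unfolding defect_def
  proof (rule integral_mono)
    fix z
    have "(wmod q z - 1)\<^sup>2 \<le> (1 + \<eta>) * (wmod p z - 1)\<^sup>2 + (1 + 1 / \<eta>) * (wmod q z - wmod p z)\<^sup>2"
      using square_add_le[OF \<open>0 < \<eta>\<close>, of "wmod p z - 1" "wmod q z - wmod p z"] by simp
    moreover have "(wmod q z - wmod p z)\<^sup>2 \<le> (wmod (p - q) z)\<^sup>2"
      using wmod_diff_le[of q z p] by (simp add: abs_le_square_iff[symmetric])
    then have "(1 + 1 / \<eta>) * (wmod q z - wmod p z)\<^sup>2 \<le> (1 + 1 / \<eta>) * (wmod (p - q) z)\<^sup>2"
      using \<open>0 < \<eta>\<close> by (intro mult_left_mono) auto
    ultimately have "(wmod q z - 1)\<^sup>2 \<le> (1 + \<eta>) * (wmod p z - 1)\<^sup>2 + (1 + 1 / \<eta>) * (wmod (p - q) z)\<^sup>2"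
      by linarith
    then show "indicator {a..<b} ((cmod z)\<^sup>2) * (wmod q z - 1)\<^sup>2
        \<le> (1 + \<eta>) * (indicator {a..<b} ((cmod z)\<^sup>2) * (wmod p z - 1)\<^sup>2)
          + (1 + 1 / \<eta>) * (indicator {a..<b} ((cmod z)\<^sup>2) * (wmod (p - q) z)\<^sup>2)"
      by (auto simp: indicator_def)
  qed (use assms int in \<open>auto intro!: integrable_defect\<close>)
  also have "\<dots> = (1 + \<eta>) * defect p {a..<b} + (1 + 1 / \<eta>) * gauss_mass (p - q) {a..<b}"
    using integrable_defect[of a b p] int assms
    by (subst Bochner_Integration.integral_add) (auto simp: defect_def gauss_mass_def)
  finally show ?thesis .
qed

section \<open>The disc and plane means in terms of defect and mass\<close>

lemma indicator_ball_square:
  assumes "0 < R"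
  shows "(indicator (ball 0 R) z :: real) = indicator {0..<R\<^sup>2} ((cmod z)\<^sup>2)"
proof -
  have "cmod z < R \<longleftrightarrow> (cmod z)\<^sup>2 < R\<^sup>2"
    using assms by (auto intro: power_strict_mono dest: power2_less_imp_less)
  then show ?thesis
    by (auto simp: indicator_def)
qed

lemma disc_mean_eq:
  assumes "0 < R"
  shows "disc_mean (poly p) R = defect p {0..<R\<^sup>2} / R\<^sup>2"
proof -
  have "indicator (ball 0 R) z *\<^sub>R Psi (poly p) z R = indicator {0..<R\<^sup>2} ((cmod z)\<^sup>2) * (wmod p z - 1)\<^sup>2" for z
    unfolding Psi_def indicator_ball_square[OF assms] by (auto simp: indicator_def wmod_def)
  then show ?thesis
    by (simp add: disc_mean_def set_lebesgue_integral_def defect_def)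
qed

lemma plane_mean_eq:
  assumes "0 < R"
  shows "plane_mean (poly p) R = (defect p {0..<R\<^sup>2} + gauss_mass p {R\<^sup>2..}) / R\<^sup>2"
proof -
  have "Psi (poly p) z R = indicator {0..<R\<^sup>2} ((cmod z)\<^sup>2) * (wmod p z - 1)\<^sup>2
      + indicator {R\<^sup>2..} ((cmod z)\<^sup>2) * (wmod p z)\<^sup>2" for z
    unfolding Psi_def indicator_ball_square[OF assms] by (auto simp: indicator_def wmod_def)
  then have "(LINT z|dA. Psi (poly p) z R) = defect p {0..<R\<^sup>2} + gauss_mass p {R\<^sup>2..}"
    using integrable_defect[of 0 "R\<^sup>2" p] integrable_wmod_square[of "{R\<^sup>2..}" p]
    by (simp add: defect_def gauss_mass_def)
  then show ?thesis
    by (simp add: plane_mean_def)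
qed

subsection \<open>Truncation\<close>

lemma poly_cutoff_in_Pol_n: "poly_cutoff m p \<in> Pol_n m"
proof (cases "poly_cutoff m p = 0")
  case False
  then have "coeff (poly_cutoff m p) (degree (poly_cutoff m p)) \<noteq> 0"
    by (simp only: leading_coeff_0_iff not_False_eq_True)
  then show ?thesis
    by (auto simp: Pol_n_def coeff_poly_cutoff split: if_splits)
qed (simp add: Pol_n_def)

lemma degree_poly_cutoff_le: "degree (poly_cutoff m p) \<le> degree p"
  by (rule degree_le) (simp add: coeff_poly_cutoff coeff_eq_0)

text \<open>By Parseval the mass is a sum of nonnegative terms over the coefficients, and the
  cut-off deletes some of them. This handles the exterior of the disc.\<close>

lemma gauss_mass_poly_cutoff_le:
  assumes [measurable]: "B \<in> sets borel"
  shows "gauss_mass (poly_cutoff m p) B \<le> gauss_mass p B"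
  unfolding gauss_mass_eq_sum[OF assms degree_poly_cutoff_le] gauss_mass_eq_sum[OF assms order_refl, of p]
  by (intro sum_mono mult_right_mono) (auto simp: coeff_poly_cutoff)

text \<open>Only exponents \<open>k \<ge> m \<ge> 2 * s\<close> survive in the tail, and for these
  the moments of disc and annulus compare term by term.\<close>

lemma gauss_mass_tail_le:
  assumes "0 < s" "2 * s \<le> real m" "0 \<le> h" "s \<le> h\<^sup>2" "h\<^sup>2 \<le> 2 * s"
  shows "gauss_mass (p - poly_cutoff m p) {0..<s} \<le> exp 3 * gauss_mass p {s..<s + h}"
proof -
  have deg: "degree (p - poly_cutoff m p) \<le> degree p"
    using degree_poly_cutoff_le[of m p] by (intro degree_diff_le) auto
  have "gauss_mass (p - poly_cutoff m p) {0..<s} =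
      (\<Sum>k\<le>degree p. (cmod (coeff (p - poly_cutoff m p) k))\<^sup>2 * gauss_moment {0..<s} k)"
    by (rule gauss_mass_eq_sum[OF _ deg]) simp
  also have "\<dots> \<le> (\<Sum>k\<le>degree p. (cmod (coeff p k))\<^sup>2 * (exp 3 * gauss_moment {s..<s + h} k))"
  proof (rule sum_mono)
    fix k
    show "(cmod (coeff (p - poly_cutoff m p) k))\<^sup>2 * gauss_moment {0..<s} k
        \<le> (cmod (coeff p k))\<^sup>2 * (exp 3 * gauss_moment {s..<s + h} k)"
    proof (cases "k < m")
      case False
      then show ?thesis
        using assms gauss_moment_disc_le_annulus[of s k h]
        by (auto simp: coeff_poly_cutoff intro!: mult_left_mono)
    qed (simp add: coeff_poly_cutoff)
  qed
  also have "\<dots> = exp 3 * gauss_mass p {s..<s + h}"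
    by (subst gauss_mass_eq_sum[OF _ order_refl]) (auto simp: sum_distrib_left mult_ac)
  finally show ?thesis .
qed

text \<open>Pigeonhole: the masses of the \<open>N\<close> disjoint annuli telescope to at most the
  total mass, so one of them is at most the average.\<close>

lemma exists_light_annulus:
  assumes "0 < N" "0 \<le> h" "real N * h \<le> S"
  obtains j where "j < N"
    "gauss_mass p {S - real (Suc j) * h..<S - real j * h} \<le> gauss_mass p {0..<S} / real N"
proof -
  define M where "M = (\<lambda>j. gauss_mass p {0..<S - real j * h})"
  have split: "gauss_mass p {S - real (Suc j) * h..<S - real j * h} = M j - M (Suc j)" if "j < N" for j
  proof -
    have "real (Suc j) * h \<le> real N * h"
      using that assms by (intro mult_right_mono) auto
    then have Un: "{0..<S - real j * h} = {0..<S - real (Suc j) * h} \<union> {S - real (Suc j) * h..<S - real j * h}"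
      using assms by (auto simp: algebra_simps)
    show ?thesis
      unfolding M_def Un by (subst gauss_mass_Un) auto
  qed
  have "\<exists>j<N. M j - M (Suc j) \<le> M 0 / real N"
  proof (rule ccontr)
    assume "\<not> ?thesis"
    then have "(\<Sum>j<N. M 0 / real N) < (\<Sum>j<N. M j - M (Suc j))"
      using assms by (intro sum_strict_mono) auto
    also have "\<dots> = M 0 - M N"
      by (rule sum_lessThan_telescope')
    also have "\<dots> \<le> M 0"
      by (simp add: M_def)
    finally show False
      using assms by simp
  qed
  then show ?thesis
    using that split by (auto simp: M_def)
qed

section \<open>Transfer of lower limits between radii\<close>

text \<open>A competitor from \<open>P\<close> at radius \<open>R\<close> is traded for one from
  \<open>Q R'\<close> at another radius. Since \<open>R' \<ge> R / 2\<close> tends to infinity with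
  \<open>R\<close>, an eventual lower bound for the restricted infimum passes to the unrestricted
  one.\<close>

lemma Liminf_INF_eqI:
  fixes F :: "'a \<Rightarrow> real \<Rightarrow> real"
  assumes sub: "\<And>R. Q R \<subseteq> P"
    and base: "p0 \<in> P" "\<And>R. 0 < R \<Longrightarrow> F p0 R \<le> 1"
    and approx: "\<And>\<epsilon>. 0 < \<epsilon> \<Longrightarrow> \<epsilon> \<le> 1 \<Longrightarrow>
      \<exists>R0. \<forall>R\<ge>R0. \<forall>p\<in>P. F p R \<le> 2 \<longrightarrow> (\<exists>R'\<ge>R / 2. \<exists>q\<in>Q R'. F q R' \<le> F p R + \<epsilon>)"
  shows "Liminf at_top (\<lambda>R. INF p\<in>P. ereal (F p R)) = Liminf at_top (\<lambda>R. INF p\<in>Q R. ereal (F p R))"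
    (is "?A = ?B")
proof (rule antisym)
  show "?A \<le> ?B"
    by (intro Liminf_mono always_eventually allI INF_superset_mono sub) auto
  show "?B \<le> ?A"
    unfolding le_Liminf_iff
  proof (intro allI impI)
    fix y assume "y < ?B"
    \<comment> \<open>The gap between the two intermediate values \<open>c1 < c2\<close> pays for
      the error \<epsilon> of the approximation.\<close>
    then obtain c2 where c2: "y < ereal c2" "ereal c2 < ?B"
      using ereal_dense2 by blast
    then obtain c1 where c1: "y < ereal c1" "c1 < c2"
      using ereal_dense2[OF c2(1)] by auto
    have "\<forall>\<^sub>F R in at_top. ereal c2 < (INF p\<in>Q R. ereal (F p R))"
      using c2(2) by (rule less_LiminfD)
    then obtain R1 where R1: "\<And>R. R \<ge> R1 \<Longrightarrow> ereal c2 < (INF p\<in>Q R. ereal (F p R))"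
      by (auto simp: eventually_at_top_linorder)
    have "\<exists>R0. \<forall>R\<ge>R0. \<forall>p\<in>P. F p R \<le> 2 \<longrightarrow>
        (\<exists>R'\<ge>R / 2. \<exists>q\<in>Q R'. F q R' \<le> F p R + min 1 (c2 - c1))"
      by (rule approx) (use c1(2) in auto)
    then obtain R0 where R0: "\<forall>R\<ge>R0. \<forall>p\<in>P. F p R \<le> 2 \<longrightarrow>
        (\<exists>R'\<ge>R / 2. \<exists>q\<in>Q R'. F q R' \<le> F p R + min 1 (c2 - c1))" ..
    \<comment> \<open>The minimum with 2 appears because \<open>approx\<close> speaks only of
      competitors with value at most 2.\<close>
    have lower: "min c1 2 \<le> F p R" if R: "R \<ge> R0" "R \<ge> 2 * R1" and p: "p \<in> P" for p R
    proof (rule ccontr)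
      assume "\<not> min c1 2 \<le> F p R"
      then have "F p R \<le> 2"
        by simp
      then obtain R' q where q: "R' \<ge> R / 2" "q \<in> Q R'" "F q R' \<le> F p R + min 1 (c2 - c1)"
        using R0 R(1) p by blast
      have "ereal c2 < (INF p\<in>Q R'. ereal (F p R'))"
        using R q by (intro R1) auto
      also have "\<dots> \<le> ereal (F q R')"
        using q by (intro INF_lower) auto
      finally show False
        using q(3) \<open>\<not> min c1 2 \<le> F p R\<close> by auto
    qed
    define R2 where "R2 = max 1 (max R0 (2 * R1))"
    have "R2 \<ge> R0" "R2 \<ge> 2 * R1" "R2 > 0"
      by (simp_all add: R2_def)
    \<comment> \<open>Since \<open>p0\<close> has value at most 1, the minimum must be
      \<open>c1\<close>, and the bound 2 drops out.\<close>
    then have "min c1 2 \<le> 1"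
      using lower[of R2 p0] base by (meson order_trans)
    then have "c1 \<le> 1"
      by simp
    show "\<forall>\<^sub>F R in at_top. y < (INF p\<in>P. ereal (F p R))"
      using eventually_ge_at_top[of R0] eventually_ge_at_top[of "2 * R1"]
    proof eventually_elim
      case (elim R)
      have "ereal c1 \<le> (INF p\<in>P. ereal (F p R))"
        using lower[OF elim] \<open>c1 \<le> 1\<close> by (intro INF_greatest) (auto simp: min_def)
      then show ?case
        using c1(1) by (rule less_le_trans[rotated])
    qed
  qed
qed

section \<open>Estimates for the cut-off polynomial\<close>

text \<open>The \<open>N\<close> annuli have width \<open>R\<close> in the squared modulus. Together
  they have depth \<open>N * R \<le> R\<^sup>2 / 2\<close>, so \<open>s\<close> stays comparable to
  \<open>R\<^sup>2\<close> and \<open>R\<close> is an admissible width in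
  \<open>gauss_mass_tail_le\<close>.\<close>

lemma truncation_estimate:
  fixes R \<eta> :: real and N :: nat
  assumes \<eta>: "0 < \<eta>" and N: "0 < N" and R: "2 * real N \<le> R"
    and p: "defect p {0..<R\<^sup>2} \<le> 2 * R\<^sup>2"
  obtains s where "R\<^sup>2 / 4 \<le> s" "R\<^sup>2 - real N * R \<le> s" "s \<le> R\<^sup>2"
    "\<And>m. 2 * s \<le> real m \<Longrightarrow> defect (poly_cutoff m p) {0..<s}
      \<le> (1 + \<eta>) * defect p {0..<s} + (1 + 1 / \<eta>) * (exp 3 * (6 * R\<^sup>2 / real N))"
proof -
  have R0: "0 < R"
    using N R by linarith
  have NR: "real N * R \<le> R\<^sup>2 / 2"
    using mult_right_mono[OF R, of R] R0 by (simp add: power2_eq_square)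
  obtain j where j: "j < N"
    "gauss_mass p {R\<^sup>2 - real (Suc j) * R..<R\<^sup>2 - real j * R} \<le> gauss_mass p {0..<R\<^sup>2} / real N"
  proof (rule exists_light_annulus)
    show "real N * R \<le> R\<^sup>2"
      using NR zero_le_power2[of R] by linarith
  qed (use N R0 in auto)
  \<comment> \<open>The inner edge of the light annulus, which becomes
    \<open>{s..<s + R}\<close>.\<close>
  define s where "s = R\<^sup>2 - real (Suc j) * R"
  have jR: "real (Suc j) * R \<le> real N * R"
    using j(1) R0 by (intro mult_right_mono) auto
  have s: "R\<^sup>2 - real N * R \<le> s" "s \<le> R\<^sup>2" "R\<^sup>2 / 2 \<le> s"
  proof -
    have "0 \<le> real (Suc j) * R"
      using R0 by simp
    then show "R\<^sup>2 - real N * R \<le> s" "s \<le> R\<^sup>2" "R\<^sup>2 / 2 \<le> s"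
      using jR NR unfolding s_def by linarith+
  qed
  have s0: "0 < s"
    using s(3) R0 by (smt (verit) zero_less_power half_gt_zero)
  \<comment> \<open>The constant 6 is \<open>2 * 2 + 2\<close>: twice the assumed defect bound plus
    twice the area.\<close>
  have "gauss_mass p {0..<R\<^sup>2} \<le> 2 * defect p {0..<R\<^sup>2} + 2 * R\<^sup>2"
    using gauss_mass_le_defect[of 0 "R\<^sup>2" 1 p] by simp
  also have "\<dots> \<le> 6 * R\<^sup>2"
    using p by simp
  finally have "gauss_mass p {0..<R\<^sup>2} / real N \<le> 6 * R\<^sup>2 / real N"
    by (intro divide_right_mono) auto
  moreover have "R\<^sup>2 - real j * R = s + R"
    by (simp add: s_def algebra_simps)
  ultimately have light: "gauss_mass p {s..<s + R} \<le> 6 * R\<^sup>2 / real N"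
    using j(2) unfolding s_def[symmetric] by simp
  show ?thesis
  proof (rule that[OF _ s(1,2)])
    show "R\<^sup>2 / 4 \<le> s"
      using s(3) zero_le_power2[of R] by linarith
    fix m :: nat assume m: "2 * s \<le> real m"
    let ?q = "poly_cutoff m p"
    have "gauss_mass (p - ?q) {0..<s} \<le> exp 3 * gauss_mass p {s..<s + R}"
      using m s s0 R0 by (intro gauss_mass_tail_le) auto
    also have "\<dots> \<le> exp 3 * (6 * R\<^sup>2 / real N)"
      using light by (intro mult_left_mono) auto
    finally have "(1 + 1 / \<eta>) * gauss_mass (p - ?q) {0..<s} \<le> (1 + 1 / \<eta>) * (exp 3 * (6 * R\<^sup>2 / real N))"
      using \<eta> by (intro mult_left_mono) auto
    then show "defect ?q {0..<s} \<le> (1 + \<eta>) * defect p {0..<s} + (1 + 1 / \<eta>) * (exp 3 * (6 * R\<^sup>2 / real N))"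
      using defect_perturb[of 0 s \<eta> ?q p] s0 \<eta> by linarith
  qed
qed

text \<open>With \<open>b = False\<close> this is the functional of the disc, with \<open>b = True\<close> that of the plane, as a
  function of the squared radius.\<close>
definition total_defect :: "bool \<Rightarrow> complex poly \<Rightarrow> real \<Rightarrow> real" where
  "total_defect b p S = defect p {0..<S} + (if b then gauss_mass p {S..} else 0)"

text \<open>The annulus between \<open>s\<close> and \<open>R\<^sup>2\<close> changes from disc to
  exterior. For the plane its mass is bounded through the defect there, with an error proportional
  to its area, at most \<open>N * R\<close>. All \<open>m \<ge> 2 * s\<close> are allowed because
  the degree bound is known only once \<open>s\<close> has been chosen.\<close>

lemma total_defect_truncation:
  fixes R \<eta> :: real and N :: nat
  assumes \<eta>: "0 < \<eta>" and N: "0 < N" and R: "2 * real N \<le> R"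
    and p: "total_defect b p (R\<^sup>2) \<le> 2 * R\<^sup>2"
  obtains s where "R\<^sup>2 / 4 \<le> s" "R\<^sup>2 - real N * R \<le> s" "s \<le> R\<^sup>2"
    "\<And>m. 2 * s \<le> real m \<Longrightarrow> total_defect b (poly_cutoff m p) s
      \<le> (1 + \<eta>) * total_defect b p (R\<^sup>2)
        + (1 + 1 / \<eta>) * (exp 3 * (6 * R\<^sup>2 / real N) + real N * R)"
proof -
  have "defect p {0..<R\<^sup>2} \<le> 2 * R\<^sup>2"
    using p gauss_mass_nonneg[of p "{R\<^sup>2..}"] unfolding total_defect_def
    by (cases b) (simp_all del: gauss_mass_nonneg)
  then obtain s where s: "R\<^sup>2 / 4 \<le> s" "R\<^sup>2 - real N * R \<le> s" "s \<le> R\<^sup>2"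
    and q: "\<And>m. 2 * s \<le> real m \<Longrightarrow> defect (poly_cutoff m p) {0..<s}
      \<le> (1 + \<eta>) * defect p {0..<s} + (1 + 1 / \<eta>) * (exp 3 * (6 * R\<^sup>2 / real N))"
    using truncation_estimate[OF \<eta> N R] by metis
  have s0: "0 \<le> s"
    using s(1) zero_le_power2[of R] by linarith
  have split: "defect p {0..<R\<^sup>2} = defect p {0..<s} + defect p {s..<R\<^sup>2}"
    using s s0 by (intro defect_split) auto
  have NR: "0 \<le> real N * R"
    using R by auto
  show ?thesis
  proof (rule that[OF s])
    fix m :: nat assume m: "2 * s \<le> real m"
    let ?q = "poly_cutoff m p"
    \<comment> \<open>The right side uses exactly the parts of \<open>total_defect b p\<close> that
      the estimate on \<open>{0..<s}\<close> leaves over.\<close>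
    have tail: "(if b then gauss_mass ?q {s..} else 0) \<le> (1 + \<eta>) * defect p {s..<R\<^sup>2}
        + (1 + 1 / \<eta>) * (real N * R) + (1 + \<eta>) * (if b then gauss_mass p {R\<^sup>2..} else 0)"
    proof (cases b)
      case True
      have "gauss_mass ?q {s..} \<le> gauss_mass p {s..}"
        by (rule gauss_mass_poly_cutoff_le) simp
      also have "gauss_mass p {s..} = gauss_mass p ({s..<R\<^sup>2} \<union> {R\<^sup>2..})"
        using s by (simp add: ivl_disj_un_one)
      also have "\<dots> = gauss_mass p {s..<R\<^sup>2} + gauss_mass p {R\<^sup>2..}"
        by (rule gauss_mass_Un) auto
      also have "gauss_mass p {s..<R\<^sup>2} \<le> (1 + \<eta>) * defect p {s..<R\<^sup>2} + (1 + 1 / \<eta>) * (R\<^sup>2 - s)"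
        using s s0 \<eta> by (intro gauss_mass_le_defect) auto
      also have "(1 + 1 / \<eta>) * (R\<^sup>2 - s) \<le> (1 + 1 / \<eta>) * (real N * R)"
        using s \<eta> by (intro mult_left_mono) auto
      also have "gauss_mass p {R\<^sup>2..} \<le> (1 + \<eta>) * gauss_mass p {R\<^sup>2..}"
        using \<eta> by (simp add: algebra_simps)
      finally show ?thesis
        using True by simp
    next
      case False
      then show ?thesis
        using \<eta> NR by (auto intro!: add_nonneg_nonneg mult_nonneg_nonneg)
    qed
    then show "total_defect b ?q s \<le> (1 + \<eta>) * total_defect b p (R\<^sup>2)
        + (1 + 1 / \<eta>) * (exp 3 * (6 * R\<^sup>2 / real N) + real N * R)"
      using q[OF m] unfolding total_defect_def split by (simp add: distrib_left)
  qed
qed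

text \<open>The choices are made in the order \<epsilon>, \<eta>, \<open>N\<close>,
  \<open>R0\<close>. Both error terms become at most \<open>\<eta>\<^sup>2 * R\<^sup>2\<close>, so
  the factor \<open>1 + 1 / \<eta>\<close> still leaves an error of order
  \<open>\<eta> * R\<^sup>2\<close>.\<close>

lemma mean_truncation:
  fixes n :: "real \<Rightarrow> nat"
  assumes n: "\<And>R. 0 < R \<Longrightarrow> 2 * R\<^sup>2 \<le> real (n R)" and \<epsilon>: "0 < \<epsilon>" "\<epsilon> \<le> 1"
  shows "\<exists>R0. \<forall>R\<ge>R0. \<forall>p. total_defect b p (R\<^sup>2) / R\<^sup>2 \<le> 2 \<longrightarrow>
    (\<exists>R'\<ge>R / 2. \<exists>q\<in>Pol_n (n R'). total_defect b q (R'\<^sup>2) / R'\<^sup>2 \<le> total_defect b p (R\<^sup>2) / R\<^sup>2 + \<epsilon>)"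
proof -
  \<comment> \<open>The divisor 16 leaves room for all losses: for \<open>a \<le> 2\<close> they add
    up to less than \<open>16 * \<eta>\<close>.\<close>
  define \<eta> where "\<eta> = \<epsilon> / 16"
  have \<eta>: "0 < \<eta>" "\<eta> \<le> 1 / 16"
    using \<epsilon> by (auto simp: \<eta>_def)
  obtain N :: nat where N: "6 * exp 3 / \<eta>\<^sup>2 < real N"
    using reals_Archimedean2 by blast
  have "0 < 6 * exp 3 / \<eta>\<^sup>2"
    using \<eta> by simp
  then have N0: "0 < N"
    using N by (metis less_trans of_nat_0_less_iff)
  have N1: "exp 3 * 6 / real N \<le> \<eta>\<^sup>2"
    using N N0 \<eta> by (simp add: field_simps)
  \<comment> \<open>The first entry makes the annuli fit into the disc, the second gives
    \<open>N * R \<le> \<eta>\<^sup>2 * R\<^sup>2\<close>.\<close>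
  define R0 where "R0 = max (2 * real N) (real N / \<eta>\<^sup>2)"
  show ?thesis
  proof (rule exI[of _ R0], intro allI impI)
    fix R p assume R: "R0 \<le> R" and p: "total_defect b p (R\<^sup>2) / R\<^sup>2 \<le> 2"
    define a where "a = total_defect b p (R\<^sup>2) / R\<^sup>2"
    have R2: "2 * real N \<le> R" "real N / \<eta>\<^sup>2 \<le> R"
      using R by (auto simp: R0_def)
    then have Rpos: "0 < R"
      using N0 by linarith
    have NR: "real N * R \<le> \<eta>\<^sup>2 * R\<^sup>2"
      using R2(2) \<eta> Rpos by (simp add: field_simps power2_eq_square)
    have aR: "total_defect b p (R\<^sup>2) = a * R\<^sup>2"
      using Rpos by (simp add: a_def)
    obtain s where s: "R\<^sup>2 / 4 \<le> s" "R\<^sup>2 - real N * R \<le> s" "s \<le> R\<^sup>2"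
      and q: "\<And>m. 2 * s \<le> real m \<Longrightarrow> total_defect b (poly_cutoff m p) s
        \<le> (1 + \<eta>) * (a * R\<^sup>2) + (1 + 1 / \<eta>) * (exp 3 * (6 * R\<^sup>2 / real N) + real N * R)"
    proof (rule total_defect_truncation[OF \<eta>(1) N0 R2(1), of b p, unfolded aR])
      show "a * R\<^sup>2 \<le> 2 * R\<^sup>2"
        using p by (intro mult_right_mono) (simp_all add: a_def)
    qed auto
    have s0: "0 < s"
      using s(1) Rpos by (smt (verit) zero_less_power zero_less_divide_iff)
    define R' where "R' = sqrt s"
    have R': "R'\<^sup>2 = s" "0 < R'"
      using s0 by (simp_all add: R'_def)
    have R'_ge: "R / 2 \<le> R'"
      unfolding R'_def by (rule real_le_rsqrt) (use s(1) in \<open>simp add: power_divide\<close>)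
    define q where "q = poly_cutoff (n R') p"
    have "exp 3 * (6 * R\<^sup>2 / real N) \<le> \<eta>\<^sup>2 * R\<^sup>2"
      using mult_right_mono[OF N1, of "R\<^sup>2"] by simp
    then have "(1 + 1 / \<eta>) * (exp 3 * (6 * R\<^sup>2 / real N) + real N * R) \<le> (1 + 1 / \<eta>) * (2 * \<eta>\<^sup>2 * R\<^sup>2)"
      using NR \<eta> by (intro mult_left_mono) auto
    also have "\<dots> = (2 * \<eta>\<^sup>2 + 2 * \<eta>) * R\<^sup>2"
      using \<eta> by (simp add: field_simps power2_eq_square)
    finally have err: "(1 + 1 / \<eta>) * (exp 3 * (6 * R\<^sup>2 / real N) + real N * R) \<le> (2 * \<eta>\<^sup>2 + 2 * \<eta>) * R\<^sup>2" .
    have "total_defect b q s \<le> (1 + \<eta>) * (a * R\<^sup>2) + (2 * \<eta>\<^sup>2 + 2 * \<eta>) * R\<^sup>2"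
      using q[of "n R'"] n[OF R'(2)] err unfolding q_def R'(1) by linarith
    also have "\<dots> = ((1 + \<eta>) * a + (2 * \<eta>\<^sup>2 + 2 * \<eta>)) * R\<^sup>2"
      by (simp add: algebra_simps)
    \<comment> \<open>The new mean is divided by \<open>s\<close> instead of
      \<open>R\<^sup>2\<close>; the factor \<open>1 - \<eta>\<close> prepares for
      \<open>(1 - \<eta>) * R\<^sup>2 \<le> s\<close>.\<close>
    also have "\<dots> \<le> ((a + \<epsilon>) * (1 - \<eta>)) * R\<^sup>2"
    proof (rule mult_right_mono)
      have "a \<le> 2"
        using p by (simp add: a_def)
      then have "\<eta> * a \<le> \<eta> * 2" "\<eta>\<^sup>2 \<le> \<eta> * (1 / 16)"
        using \<eta> unfolding power2_eq_square by (auto intro!: mult_left_mono)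
      moreover have "(a + \<epsilon>) * (1 - \<eta>) = a - \<eta> * a + 16 * \<eta> - 16 * \<eta>\<^sup>2"
        by (simp add: \<eta>_def algebra_simps power2_eq_square)
      ultimately show "(1 + \<eta>) * a + (2 * \<eta>\<^sup>2 + 2 * \<eta>) \<le> (a + \<epsilon>) * (1 - \<eta>)"
        using \<eta> unfolding distrib_right by linarith
    qed simp
    also have "\<dots> = (a + \<epsilon>) * ((1 - \<eta>) * R\<^sup>2)"
      by simp
    also have "\<dots> \<le> (a + \<epsilon>) * s"
    proof (rule mult_left_mono)
      have "\<eta>\<^sup>2 * R\<^sup>2 \<le> \<eta> * R\<^sup>2"
        using \<eta> by (intro mult_right_mono) (auto simp: power2_eq_square)
      then show "(1 - \<eta>) * R\<^sup>2 \<le> s"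
        using s(2) NR by (simp add: left_diff_distrib)
      show "0 \<le> a + \<epsilon>"
        using \<epsilon> by (auto simp: a_def total_defect_def intro!: add_nonneg_nonneg divide_nonneg_nonneg)
    qed
    finally have "total_defect b q (R'\<^sup>2) / R'\<^sup>2 \<le> a + \<epsilon>"
      using s0 unfolding R'(1) by (simp add: pos_divide_le_eq)
    then show "\<exists>R'\<ge>R / 2. \<exists>q\<in>Pol_n (n R'). total_defect b q (R'\<^sup>2) / R'\<^sup>2 \<le> total_defect b p (R\<^sup>2) / R\<^sup>2 + \<epsilon>"
      using R'_ge poly_cutoff_in_Pol_n[of "n R'" p] unfolding a_def q_def by blast
  qed
qed

lemma Liminf_INF_total_defect:
  fixes n :: "real \<Rightarrow> nat"
  assumes n: "\<And>R. 0 < R \<Longrightarrow> 2 * R\<^sup>2 \<le> real (n R)"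
  shows "Liminf at_top (\<lambda>R. INF p\<in>Pol. ereal (total_defect b p (R\<^sup>2) / R\<^sup>2)) =
    Liminf at_top (\<lambda>R. INF p\<in>Pol_n (n R). ereal (total_defect b p (R\<^sup>2) / R\<^sup>2))"
proof (rule Liminf_INF_eqI)
  \<comment> \<open>The zero polynomial serves as \<open>p0\<close>: it has no mass, and its defect
    is the area of the disc.\<close>
  show "total_defect b 0 (R\<^sup>2) / R\<^sup>2 \<le> 1" for R
    by (simp add: total_defect_def defect_0)
qed (use mean_truncation[OF n, of _ b] in \<open>auto simp: Pol_def\<close>)

theorem corollary1p5:
  fixes n :: "real \<Rightarrow> nat"
  assumes "\<And>R. R > 0 \<Longrightarrow> int (n R) = \<lceil>2 * R\<^sup>2\<rceil>"
  shows "rho = Liminf at_top (\<lambda>R. INF p\<in>Pol_n (n R). ereal (disc_mean (poly p) R)) \<and>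
    rho_star = Liminf at_top (\<lambda>R. INF p\<in>Pol_n (n R). ereal (plane_mean (poly p) R))"
proof
  have n: "2 * R\<^sup>2 \<le> real (n R)" if "0 < R" for R
    using le_of_int_ceiling[of "2 * R\<^sup>2"] assms[OF that] by (metis of_int_of_nat_eq)
  \<comment> \<open>Identities for positive radii suffice, since the lower limit at infinity ignores
    all others.\<close>
  have cong: "Liminf at_top (\<lambda>R. INF p\<in>A R. ereal (F p R)) = Liminf at_top (\<lambda>R. INF p\<in>A R. ereal (G p R))"
    if "\<And>p R. 0 < R \<Longrightarrow> F p R = G p R" for A :: "real \<Rightarrow> complex poly set" and F G
    by (rule Liminf_eq, rule eventually_mono[OF eventually_gt_at_top[of 0]]) (simp add: that)
  have disc: "disc_mean (poly p) R = total_defect False p (R\<^sup>2) / R\<^sup>2"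
    and plane: "plane_mean (poly p) R = total_defect True p (R\<^sup>2) / R\<^sup>2" if "0 < R" for p R
    by (simp_all add: that total_defect_def disc_mean_eq plane_mean_eq)
  have "rho = Liminf at_top (\<lambda>R. INF p\<in>Pol. ereal (total_defect False p (R\<^sup>2) / R\<^sup>2))"
    unfolding rho_def by (rule cong) (rule disc)
  also have "\<dots> = Liminf at_top (\<lambda>R. INF p\<in>Pol_n (n R). ereal (total_defect False p (R\<^sup>2) / R\<^sup>2))"
    by (rule Liminf_INF_total_defect[OF n])
  also have "\<dots> = Liminf at_top (\<lambda>R. INF p\<in>Pol_n (n R). ereal (disc_mean (poly p) R))"
    by (rule cong) (rule disc[symmetric])
  finally show "rho = Liminf at_top (\<lambda>R. INF p\<in>Pol_n (n R). ereal (disc_mean (poly p) R))" .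
  have "rho_star = Liminf at_top (\<lambda>R. INF p\<in>Pol. ereal (total_defect True p (R\<^sup>2) / R\<^sup>2))"
    unfolding rho_star_def by (rule cong) (rule plane)
  also have "\<dots> = Liminf at_top (\<lambda>R. INF p\<in>Pol_n (n R). ereal (total_defect True p (R\<^sup>2) / R\<^sup>2))"
    by (rule Liminf_INF_total_defect[OF n])
  also have "\<dots> = Liminf at_top (\<lambda>R. INF p\<in>Pol_n (n R). ereal (plane_mean (poly p) R))"
    by (rule cong) (rule plane[symmetric])
  finally show "rho_star = Liminf at_top (\<lambda>R. INF p\<in>Pol_n (n R). ereal (plane_mean (poly p) R))" .
qed

end
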